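(* If $G$ is an $\mathcal{R}_2$-connected $2$-stress-independent graph on at least five vertices, then $G$ does not contain a subgraph isomorphic to $K_4$.
   Context: All graphs are finite and simple. A framework $(G,p)$ in $\mathbb{R}^2$ is generic if its coordinates are algebraically independent over $\mathbb{Q}$. $\mathcal{R}_2(G)$ is the row matroid of the rigidity matrix of a generic framework in $\mathbb{R}^2$ (row of edge $xy$: $p(x)-p(y)$ in the columns of $x$, $p(y)-p(x)$ in those of $y$, zeros elsewhere), rank $r_2$. $G$ is $\mathcal{R}_2$-connected if $\mathcal{R}_2(G)$ is a connected matroid (every two edges lie in a common circuit) and $G$ has no isolated vertices. $\{u,v\}$ is $2$-linked in $G$ if $r_2(G+uv)=r_2(G)$. A stress of $(G,p)$ is $\omega\in\mathbb{R}^E$ with $\sum_{x:xy\in E}\omega(xy)(p(x)-p(y))=0$ for every vertex $y$; $S(G,p)$ is the stress space. $\{u,v\}$ is $2$-stress-linked in $G$ if it is $2$-linked and for every generic $(G,p)$ and every $(G,q)$ in $\mathbb{R}^2$ with $S(G,p)\subseteq S(G,q)$ we have $S(G+uv,p)\subseteq S(G+uv,q)$. $G$ is $2$-stress-independent if $\{u,v\}$ is not $2$-stress-linked in $G-uv$ for every edge $uv$. *)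

theory Defs
  imports "HOL-Analysis.Analysis" "HOL-Library.Poly_Mapping"
begin

subsection \<open>Finite simple graphs\<close>

type_synonym 'a graph = "'a set \<times> 'a set set"

abbreviation verts :: "'a graph \<Rightarrow> 'a set" where "verts G \<equiv> fst G"
abbreviation edges :: "'a graph \<Rightarrow> 'a set set" where "edges G \<equiv> snd G"

definition simple_graph :: "'a graph \<Rightarrow> bool" where
  "simple_graph G \<longleftrightarrow>
     finite (verts G) \<and> (\<forall>e\<in>edges G. e \<subseteq> verts G \<and> card e = 2)"

definition add_edge :: "'a graph \<Rightarrow> 'a \<Rightarrow> 'a \<Rightarrow> 'a graph" where
  "add_edge G u v = (verts G, insert {u, v} (edges G))"

definition del_edge :: "'a graph \<Rightarrow> 'a \<Rightarrow> 'a \<Rightarrow> 'a graph" where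
  "del_edge G u v = (verts G, edges G - {{u, v}})"

definition subgraph :: "'a graph \<Rightarrow> 'a graph \<Rightarrow> bool" where
  "subgraph H G \<longleftrightarrow>
     simple_graph H \<and> verts H \<subseteq> verts G \<and> edges H \<subseteq> edges G"

definition graph_isomorphic :: "'a graph \<Rightarrow> 'b graph \<Rightarrow> bool" where
  "graph_isomorphic G H \<longleftrightarrow>
     (\<exists>f. bij_betw f (verts G) (verts H) \<and>
          (\<forall>x\<in>verts G. \<forall>y\<in>verts G. {x, y} \<in> edges G \<longleftrightarrow> {f x, f y} \<in> edges H))"

definition complete_graph :: "nat \<Rightarrow> nat graph" where
  "complete_graph n = ({..<n}, {e. e \<subseteq> {..<n} \<and> card e = 2})"

subsection \<open>Generic frameworks\<close>

text \<open>
  Polynomials over the rationals in indeterminates indexed by \<open>'i\<close> are finitely supported maps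
  from monomials (finitely supported exponent vectors) to coefficients.
\<close>

definition mpoly_eval :: "(('i \<Rightarrow>\<^sub>0 nat) \<Rightarrow>\<^sub>0 rat) \<Rightarrow> ('i \<Rightarrow> real) \<Rightarrow> real" where
  "mpoly_eval P x =
     (\<Sum>m\<in>Poly_Mapping.keys P. of_rat (Poly_Mapping.lookup P m) *
        (\<Prod>i\<in>Poly_Mapping.keys m. x i ^ Poly_Mapping.lookup m i))"

definition algebraically_independent :: "'i set \<Rightarrow> ('i \<Rightarrow> real) \<Rightarrow> bool" where
  "algebraically_independent I x \<longleftrightarrow>
     (\<forall>P. (\<forall>m\<in>Poly_Mapping.keys P. Poly_Mapping.keys m \<subseteq> I) \<longrightarrow>
        mpoly_eval P x = 0 \<longrightarrow> P = 0)"

text \<open>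
  A framework on a vertex set \<open>V\<close> is given by a total map; its values outside \<open>V\<close> are irrelevant.
\<close>

definition generic :: "'a set \<Rightarrow> ('a \<Rightarrow> real ^ 2) \<Rightarrow> bool" where
  "generic V p \<longleftrightarrow> algebraically_independent (V \<times> UNIV) (\<lambda>(v, i). p v $ i)"

subsection \<open>The rigidity matroid\<close>

text \<open>
  The two columns of a vertex \<open>v\<close> are grouped into one entry in \<open>real ^ 2\<close>;
  for \<open>v \<in> e\<close>, \<open>the_elem (e - {v})\<close> is the other end of \<open>e\<close>.
\<close>

definition rigidity_row :: "('a \<Rightarrow> real ^ 2) \<Rightarrow> 'a set \<Rightarrow> 'a \<Rightarrow> real ^ 2" where
  "rigidity_row p e v = (if v \<in> e then p v - p (the_elem (e - {v})) else 0)"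

lemma rigidity_row_edge:
  assumes "x \<noteq> y"
  shows "rigidity_row p {x, y} =
           (\<lambda>v. if v = x then p x - p y else if v = y then p y - p x else 0)"
proof -
  have "{x, y} - {x} = {y}" "{x, y} - {y} = {x}"
    using assms by auto
  then show ?thesis
    by (auto simp: rigidity_row_def fun_eq_iff)
qed

definition rows_independent :: "('a \<Rightarrow> real ^ 2) \<Rightarrow> 'a set set \<Rightarrow> bool" where
  "rows_independent p F \<longleftrightarrow>
     (\<forall>c. (\<forall>v. (\<Sum>e\<in>F. c e *\<^sub>R rigidity_row p e v) = 0) \<longrightarrow> (\<forall>e\<in>F. c e = 0))"

text \<open>
  The row matroid is the same for all generic frameworks on \<open>V\<close>; one of them is fixed here.
  The choice depends on \<open>V\<close> only, so graphs on the same vertex set use the same framework.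
\<close>

definition generic_placement :: "'a set \<Rightarrow> 'a \<Rightarrow> real ^ 2" where
  "generic_placement V = (SOME p. generic V p)"

definition R2_indep :: "'a graph \<Rightarrow> 'a set set \<Rightarrow> bool" where
  "R2_indep G F \<longleftrightarrow> F \<subseteq> edges G \<and> rows_independent (generic_placement (verts G)) F"

definition r2 :: "'a graph \<Rightarrow> nat" where
  "r2 G = Max {card F | F. R2_indep G F}"

definition R2_circuit :: "'a graph \<Rightarrow> 'a set set \<Rightarrow> bool" where
  "R2_circuit G C \<longleftrightarrow>
     C \<subseteq> edges G \<and> \<not> R2_indep G C \<and> (\<forall>F. F \<subset> C \<longrightarrow> R2_indep G F)"

definition R2_connected :: "'a graph \<Rightarrow> bool" where
  "R2_connected G \<longleftrightarrow>
     (\<forall>e\<in>edges G. \<forall>f\<in>edges G. e \<noteq> f \<longrightarrow> (\<exists>C. R2_circuit G C \<and> e \<in> C \<and> f \<in> C)) \<and>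
     (\<forall>v\<in>verts G. \<exists>e\<in>edges G. v \<in> e)"

subsection \<open>Stresses\<close>

text \<open>Vectors indexed by the edges are maps on all vertex sets that vanish off the edge set.\<close>

definition stress_space :: "'a graph \<Rightarrow> ('a \<Rightarrow> real ^ 2) \<Rightarrow> ('a set \<Rightarrow> real) set" where
  "stress_space G p =
     {\<omega>. (\<forall>e. e \<notin> edges G \<longrightarrow> \<omega> e = 0) \<and>
          (\<forall>y\<in>verts G. (\<Sum>x | {x, y} \<in> edges G. \<omega> {x, y} *\<^sub>R (p x - p y)) = 0)}"

definition two_linked :: "'a graph \<Rightarrow> 'a \<Rightarrow> 'a \<Rightarrow> bool" where
  "two_linked G u v \<longleftrightarrow>
     u \<in> verts G \<and> v \<in> verts G \<and> u \<noteq> v \<and> r2 (add_edge G u v) = r2 G"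

definition two_stress_linked :: "'a graph \<Rightarrow> 'a \<Rightarrow> 'a \<Rightarrow> bool" where
  "two_stress_linked G u v \<longleftrightarrow>
     two_linked G u v \<and>
     (\<forall>p q. generic (verts G) p \<longrightarrow> stress_space G p \<subseteq> stress_space G q \<longrightarrow>
        stress_space (add_edge G u v) p \<subseteq> stress_space (add_edge G u v) q)"

definition two_stress_independent :: "'a graph \<Rightarrow> bool" where
  "two_stress_independent G \<longleftrightarrow>
     (\<forall>u v. {u, v} \<in> edges G \<longrightarrow> \<not> two_stress_linked (del_edge G u v) u v)"

end

theory Submission
  imports Defs
begin

text \<open>
  Let \<open>K\<close> be a copy of \<open>K\<^sub>4\<close> in \<open>G\<close> and let \<open>l\<close> be the affine dependency of its four points at
  a generic placement; the stress of \<open>K\<close> is \<open>xy \<mapsto> l x * l y\<close>. Write \<open>L \<omega>\<close> for the weighted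
  Laplacian (stress matrix, up to sign) of a stress \<open>\<omega>\<close>. If the edge \<open>uv\<close> of \<open>K\<close> is not
  stress-linked in \<open>G - uv\<close>, there is a function \<open>h\<close> on the vertices with \<open>\<Sum>x. l x * h x = 1\<close> and
  \<open>L \<omega> h = (\<omega> uv / (l u * l v)) l\<close>. Given two such edges with functions \<open>h\<close> and \<open>h'\<close>, evaluating the
  symmetric form \<open>L \<omega>\<close> at \<open>h\<close> and \<open>h'\<close> in both orders shows that \<open>\<omega> uv / (l u * l v)\<close> is the same
  for both edges. So if no edge of \<open>K\<close> is stress-linked, every stress of \<open>G\<close> agrees on \<open>K\<close> with a
  multiple of the stress of \<open>K\<close>. Take a circuit through an edge of \<open>K\<close> and an edge outside \<open>K\<close>:
  subtracting that multiple from its stress leaves a nonzero stress on a proper subset of the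
  circuit, a contradiction.

  The placements that witness the failure for different edges may differ. They are moved to one
  common placement by the fact that a linear system with polynomial coefficients that is solvable
  at one generic placement is solvable at all of them.
\<close>

section \<open>Polynomial functions of a placement\<close>

lemma mpoly_eval_superset:
  assumes "finite M" "Poly_Mapping.keys P \<subseteq> M"
  shows "mpoly_eval P x =
    (\<Sum>m\<in>M. of_rat (Poly_Mapping.lookup P m) *
      (\<Prod>i\<in>Poly_Mapping.keys m. x i ^ Poly_Mapping.lookup m i))"
  unfolding mpoly_eval_def using assms
  by (intro sum.mono_neutral_left) (auto simp: in_keys_iff)

lemma mpoly_eval_0 [simp]: "mpoly_eval 0 x = 0"
  by (simp add: mpoly_eval_def)

lemma mpoly_eval_add: "mpoly_eval (P + Q) x = mpoly_eval P x + mpoly_eval Q x"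
proof -
  let ?M = "Poly_Mapping.keys P \<union> Poly_Mapping.keys Q"
  have "Poly_Mapping.keys (P + Q) \<subseteq> ?M"
    by (rule Poly_Mapping.keys_add)
  then show ?thesis
    by (simp add: mpoly_eval_superset[of ?M] lookup_add of_rat_add algebra_simps sum.distrib)
qed

lemma mpoly_eval_single:
  "mpoly_eval (Poly_Mapping.single m c) x =
    of_rat c * (\<Prod>i\<in>Poly_Mapping.keys m. x i ^ Poly_Mapping.lookup m i)"
  by (subst mpoly_eval_superset[of "{m}"]) auto

lemma mpoly_eval_sum: "mpoly_eval (\<Sum>a\<in>A. P a) x = (\<Sum>a\<in>A. mpoly_eval (P a) x)"
  by (induction A rule: infinite_finite_induct) (auto simp: mpoly_eval_add)

lemma monomial_eval_add:
  fixes x :: "'i \<Rightarrow> real"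
  shows "(\<Prod>i\<in>Poly_Mapping.keys (m + n). x i ^ Poly_Mapping.lookup (m + n) i) =
    (\<Prod>i\<in>Poly_Mapping.keys m. x i ^ Poly_Mapping.lookup m i) *
    (\<Prod>i\<in>Poly_Mapping.keys n. x i ^ Poly_Mapping.lookup n i)"
proof -
  let ?M = "Poly_Mapping.keys m \<union> Poly_Mapping.keys n"
  have eq: "(\<Prod>i\<in>Poly_Mapping.keys k. x i ^ Poly_Mapping.lookup k i) =
      (\<Prod>i\<in>?M. x i ^ Poly_Mapping.lookup k i)" if "Poly_Mapping.keys k \<subseteq> ?M" for k
    using that by (intro prod.mono_neutral_left) (auto simp: in_keys_iff)
  have "Poly_Mapping.keys (m + n) \<subseteq> ?M"
    by (rule Poly_Mapping.keys_add)
  then have "(\<Prod>i\<in>Poly_Mapping.keys (m + n). x i ^ Poly_Mapping.lookup (m + n) i) =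
      (\<Prod>i\<in>?M. x i ^ Poly_Mapping.lookup (m + n) i)"
    by (rule eq)
  then show ?thesis
    by (simp only: eq[of m, OF Un_upper1] eq[of n, OF Un_upper2] lookup_add power_add prod.distrib)
qed

lemma poly_mapping_sum_singles:
  "P = (\<Sum>m\<in>Poly_Mapping.keys P. Poly_Mapping.single m (Poly_Mapping.lookup P m))"
proof (rule poly_mapping_eqI)
  fix k
  show "Poly_Mapping.lookup P k = Poly_Mapping.lookup
      (\<Sum>m\<in>Poly_Mapping.keys P. Poly_Mapping.single m (Poly_Mapping.lookup P m)) k"
    by (simp add: lookup_sum lookup_single when_def in_keys_iff)
qed

lemma mpoly_eval_mult: "mpoly_eval (P * Q) x = mpoly_eval P x * mpoly_eval Q x"
proof -
  let ?s = "\<lambda>R m. Poly_Mapping.single m (Poly_Mapping.lookup R m)"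
  have "P * Q = (\<Sum>m\<in>Poly_Mapping.keys P. \<Sum>n\<in>Poly_Mapping.keys Q. ?s P m * ?s Q n)"
    by (subst poly_mapping_sum_singles[of P], subst poly_mapping_sum_singles[of Q])
      (simp only: sum_product)
  then have "mpoly_eval (P * Q) x =
      (\<Sum>m\<in>Poly_Mapping.keys P. \<Sum>n\<in>Poly_Mapping.keys Q. mpoly_eval (?s P m * ?s Q n) x)"
    by (simp only: mpoly_eval_sum)
  also have "\<dots> = (\<Sum>m\<in>Poly_Mapping.keys P. \<Sum>n\<in>Poly_Mapping.keys Q.
      mpoly_eval (?s P m) x * mpoly_eval (?s Q n) x)"
    by (simp add: mult_single mpoly_eval_single monomial_eval_add of_rat_mult algebra_simps)
  also have "\<dots> = mpoly_eval P x * mpoly_eval Q x"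
    unfolding mpoly_eval_single by (simp add: mpoly_eval_def sum_product)
  finally show ?thesis .
qed

section \<open>Functions that are rational polynomials in the coordinates\<close>

text \<open>Only coordinates of vertices in \<open>V\<close> may occur, so that genericity on
  \<open>V\<close> applies to the polynomial. Agreement is required at every placement, generic or
  not.\<close>

definition polyfun :: "'a set \<Rightarrow> (('a \<Rightarrow> real ^ 2) \<Rightarrow> real) \<Rightarrow> bool" where
  "polyfun V f \<longleftrightarrow>
     (\<exists>P. (\<forall>m\<in>Poly_Mapping.keys P. Poly_Mapping.keys m \<subseteq> V \<times> UNIV) \<and>
          (\<forall>p. f p = mpoly_eval P (\<lambda>(v, i). p v $ i)))"

lemma polyfun_of_rat: "polyfun V (\<lambda>p. of_rat c)"
  unfolding polyfun_def
  by (rule exI[of _ "Poly_Mapping.single 0 c"]) (auto simp: mpoly_eval_single)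

lemma polyfun_0: "polyfun V (\<lambda>p. 0)"
  using polyfun_of_rat[of V 0] by simp

lemma polyfun_1: "polyfun V (\<lambda>p. 1)"
  using polyfun_of_rat[of V 1] by simp

lemma polyfun_coord:
  assumes "v \<in> V"
  shows "polyfun V (\<lambda>p. p v $ i)"
  unfolding polyfun_def
  by (rule exI[of _ "Poly_Mapping.single (Poly_Mapping.single (v, i) 1) 1"])
    (use assms in \<open>auto simp: mpoly_eval_single\<close>)

lemma polyfun_add:
  assumes "polyfun V f" "polyfun V g"
  shows "polyfun V (\<lambda>p. f p + g p)"
proof -
  obtain P Q where P:
    "\<forall>m\<in>Poly_Mapping.keys P. Poly_Mapping.keys m \<subseteq> V \<times> UNIV"
    "\<forall>p. f p = mpoly_eval P (\<lambda>(v, i). p v $ i)" and Q: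
    "\<forall>m\<in>Poly_Mapping.keys Q. Poly_Mapping.keys m \<subseteq> V \<times> UNIV"
    "\<forall>p. g p = mpoly_eval Q (\<lambda>(v, i). p v $ i)"
    using assms by (auto simp: polyfun_def)
  have "\<forall>m\<in>Poly_Mapping.keys (P + Q). Poly_Mapping.keys m \<subseteq> V \<times> UNIV"
    using P(1) Q(1) Poly_Mapping.keys_add[of P Q] by blast
  then show ?thesis
    unfolding polyfun_def using P(2) Q(2)
    by (intro exI[of _ "P + Q"]) (auto simp: mpoly_eval_add)
qed

lemma polyfun_mult:
  assumes "polyfun V f" "polyfun V g"
  shows "polyfun V (\<lambda>p. f p * g p)"
proof -
  obtain P Q where P:
    "\<forall>m\<in>Poly_Mapping.keys P. Poly_Mapping.keys m \<subseteq> V \<times> UNIV"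
    "\<forall>p. f p = mpoly_eval P (\<lambda>(v, i). p v $ i)" and Q:
    "\<forall>m\<in>Poly_Mapping.keys Q. Poly_Mapping.keys m \<subseteq> V \<times> UNIV"
    "\<forall>p. g p = mpoly_eval Q (\<lambda>(v, i). p v $ i)"
    using assms by (auto simp: polyfun_def)
  have "Poly_Mapping.keys k \<subseteq> V \<times> UNIV" if k: "k \<in> Poly_Mapping.keys (P * Q)" for k
  proof -
    obtain m n where mn: "m \<in> Poly_Mapping.keys P" "n \<in> Poly_Mapping.keys Q" "k = m + n"
      using k Poly_Mapping.keys_mult[of P Q] by blast
    then show ?thesis
      using P(1) Q(1) Poly_Mapping.keys_add[of m n] by blast
  qed
  then show ?thesis
    unfolding polyfun_def using P(2) Q(2)
    by (intro exI[of _ "P * Q"]) (auto simp: mpoly_eval_mult)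
qed

lemma polyfun_uminus: "polyfun V f \<Longrightarrow> polyfun V (\<lambda>p. - f p)"
  using polyfun_mult[OF polyfun_of_rat[of V "-1"], of f] by simp

lemma polyfun_diff: "polyfun V f \<Longrightarrow> polyfun V g \<Longrightarrow> polyfun V (\<lambda>p. f p - g p)"
  using polyfun_add[OF _ polyfun_uminus, of V f g] by simp

lemma polyfun_if: "polyfun V f \<Longrightarrow> polyfun V g \<Longrightarrow> polyfun V (\<lambda>p. if B then f p else g p)"
  by (cases B) simp_all

lemma polyfun_sum:
  assumes "\<And>a. a \<in> A \<Longrightarrow> polyfun V (f a)"
  shows "polyfun V (\<lambda>p. \<Sum>a\<in>A. f a p)"
  using assms
  by (induction A rule: infinite_finite_induct) (auto intro: polyfun_add polyfun_0)

lemmas polyfun_intros =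
  polyfun_0 polyfun_1 polyfun_coord polyfun_add polyfun_mult polyfun_uminus polyfun_diff polyfun_sum

text \<open>Algebraic independence forces the representing polynomial itself to be 0. All transfer
  from one generic placement to another rests on this.\<close>

lemma polyfun_generic_zero:
  assumes "polyfun V f" "generic V p" "f p = 0"
  shows "f q = 0"
proof -
  obtain P where P: "\<forall>m\<in>Poly_Mapping.keys P. Poly_Mapping.keys m \<subseteq> V \<times> UNIV"
    "\<And>p. f p = mpoly_eval P (\<lambda>(v, i). p v $ i)"
    using assms(1) by (auto simp: polyfun_def)
  have "P = 0"
    using assms(2,3) P by (auto simp: generic_def algebraically_independent_def)
  then show ?thesis
    by (simp add: P(2))
qed

section \<open>Linear systems with polynomial coefficients\<close>

text \<open>
  Gaussian elimination without division: pivots that vanish at one generic placement vanish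
  everywhere, so the same pivots work at all generic placements.
\<close>

lemma generic_linear_system:
  fixes A :: "'i \<Rightarrow> 'j \<Rightarrow> ('a \<Rightarrow> real ^ 2) \<Rightarrow> real"
  assumes "finite J"
    and "\<And>i j. i \<in> I \<Longrightarrow> j \<in> J \<Longrightarrow> polyfun V (A i j)"
    and "\<And>i. i \<in> I \<Longrightarrow> polyfun V (b i)"
    and "generic V p0"
    and "\<And>i. i \<in> I \<Longrightarrow> (\<Sum>j\<in>J. A i j p0 * z0 j) = b i p0"
  shows "\<exists>z d. (\<forall>j\<in>J. polyfun V (z j)) \<and> polyfun V d \<and>
    (\<forall>p. generic V p \<longrightarrow>
      d p \<noteq> 0 \<and> (\<forall>i\<in>I. (\<Sum>j\<in>J. A i j p * z j p) = d p * b i p))"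
  using assms(1-3,5)
proof (induction J arbitrary: A b rule: finite_induct)
  case empty
  \<comment> \<open>With no unknowns left, solvability at \<open>p0\<close> says that every
    \<open>b i\<close> vanishes at \<open>p0\<close>, hence identically.\<close>
  have "b i p = 0" if "i \<in> I" for i p
    using polyfun_generic_zero[OF empty(2)[OF that] assms(4)] empty(3)[OF that] by simp
  then show ?case
    by (intro exI[of _ "\<lambda>_ _. 0"] exI[of _ "\<lambda>_. 1"]) (auto intro: polyfun_1)
next
  case (insert k J)
  note sol = insert.prems(3)[simplified sum.insert[OF insert.hyps]]
  show ?case
  proof (cases "\<forall>i\<in>I. A i k p0 = 0")
    case True
    \<comment> \<open>The column of \<open>k\<close> vanishes at every placement, so the unknown
      \<open>k\<close> can be set to 0.\<close>
    have Ak: "A i k p = 0" if "i \<in> I" for i p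
      using polyfun_generic_zero[OF insert.prems(1)[OF that] assms(4), of k] True that by simp
    obtain z d where zd: "\<forall>j\<in>J. polyfun V (z j)" "polyfun V d"
      "\<And>p. generic V p \<Longrightarrow>
        d p \<noteq> 0 \<and> (\<forall>i\<in>I. (\<Sum>j\<in>J. A i j p * z j p) = d p * b i p)"
      using insert.IH[of A b] insert.prems(1,2) sol True by auto
    have "(\<Sum>j\<in>insert k J. A i j p * (z(k := \<lambda>_. 0)) j p) = (\<Sum>j\<in>J. A i j p * z j p)"
      for i p
      using insert.hyps by (auto intro!: sum.cong)
    then show ?thesis
      using zd polyfun_0 by (intro exI[of _ "z(k := \<lambda>_. 0)"] exI[of _ d]) auto
  next
    case False
    then obtain i0 where i0: "i0 \<in> I" "A i0 k p0 \<noteq> 0"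
      by auto
    define \<alpha> where "\<alpha> = A i0 k"
    have \<alpha>: "polyfun V \<alpha>" "\<And>p. generic V p \<Longrightarrow> \<alpha> p \<noteq> 0"
      unfolding \<alpha>_def using insert.prems(1) i0 polyfun_generic_zero[of V "A i0 k" _ p0] by auto
    \<comment> \<open>Cross-multiplied elimination of the unknown \<open>k\<close> with pivot
      \<alpha>, which keeps the coefficients polynomial.\<close>
    define A' where "A' = (\<lambda>i j p. \<alpha> p * A i j p - A i k p * A i0 j p)"
    define b' where "b' = (\<lambda>i p. \<alpha> p * b i p - A i k p * b i0 p)"
    have red: "(\<Sum>j\<in>J. A' i j p * z j) =
        \<alpha> p * (\<Sum>j\<in>J. A i j p * z j) - A i k p * (\<Sum>j\<in>J. A i0 j p * z j)" for i p and z :: "'j \<Rightarrow> real"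
      by (simp add: A'_def algebra_simps sum_subtractf sum_distrib_left)
    have "(\<Sum>j\<in>J. A' i j p0 * z0 j) = b' i p0" if "i \<in> I" for i
    proof -
      have s: "(\<Sum>j\<in>J. A i j p0 * z0 j) = b i p0 - A i k p0 * z0 k"
        "(\<Sum>j\<in>J. A i0 j p0 * z0 j) = b i0 p0 - A i0 k p0 * z0 k"
        using sol[OF that] sol[OF i0(1)] by linarith+
      then show ?thesis
        unfolding red b'_def \<alpha>_def s by (simp add: algebra_simps)
    qed
    moreover have "polyfun V (A' i j)" if "i \<in> I" "j \<in> J" for i j
      unfolding A'_def using that i0 insert.prems(1) \<alpha>(1)
      by (intro polyfun_intros) auto
    moreover have "polyfun V (b' i)" if "i \<in> I" for i
      unfolding b'_def using that i0 insert.prems(1,2) \<alpha>(1)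
      by (intro polyfun_intros) auto
    ultimately obtain z d where zd: "\<forall>j\<in>J. polyfun V (z j)" "polyfun V d"
      "\<And>p. generic V p \<Longrightarrow> d p \<noteq> 0"
      "\<And>p i. generic V p \<Longrightarrow> i \<in> I \<Longrightarrow> (\<Sum>j\<in>J. A' i j p * z j p) = d p * b' i p"
      using insert.IH[of A' b'] by auto
    \<comment> \<open>Back substitution into equation \<open>i0\<close>, with all unknowns scaled by
      \<alpha> times \<open>d\<close> to clear both denominators.\<close>
    define z' where "z' = (\<lambda>j p. if j = k then d p * b i0 p - (\<Sum>j\<in>J. A i0 j p * z j p)
      else \<alpha> p * z j p)"
    have "polyfun V (z' j)" if "j \<in> insert k J" for j
    proof (cases "j = k")
      case True
      have "polyfun V (\<lambda>p. d p * b i0 p - (\<Sum>j\<in>J. A i0 j p * z j p))"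
        using zd i0 insert.prems(1,2) by (intro polyfun_intros) auto
      then show ?thesis
        using True by (simp add: z'_def)
    next
      case False
      then show ?thesis
        using that zd \<alpha> by (auto simp: z'_def intro: polyfun_mult)
    qed
    moreover have "(\<Sum>j\<in>insert k J. A i j p * z' j p) = \<alpha> p * d p * b i p"
      if "generic V p" "i \<in> I" for i p
    proof -
      have "(\<Sum>j\<in>J. A i j p * z' j p) = \<alpha> p * (\<Sum>j\<in>J. A i j p * z j p)"
        using insert.hyps by (auto simp: z'_def sum_distrib_left intro!: sum.cong)
      then have "(\<Sum>j\<in>insert k J. A i j p * z' j p) = \<alpha> p * (\<Sum>j\<in>J. A i j p * z j p)
          + A i k p * (d p * b i0 p - (\<Sum>j\<in>J. A i0 j p * z j p))"
        using insert.hyps by (simp add: z'_def)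
      also have "\<dots> = (\<Sum>j\<in>J. A' i j p * z j p) + A i k p * d p * b i0 p"
        unfolding red by (simp add: algebra_simps)
      also have "\<dots> = \<alpha> p * d p * b i p"
        unfolding zd(4)[OF that] b'_def by (simp add: algebra_simps)
      finally show ?thesis .
    qed
    ultimately show ?thesis
      using zd \<alpha> by (intro exI[of _ z'] exI[of _ "\<lambda>p. \<alpha> p * d p"]) (auto intro: polyfun_mult)
  qed
qed

section \<open>Stresses and circuits\<close>

text \<open>The weighted Laplacian of \<omega> applied to the potential \<open>h\<close>. Summing
  over all of \<open>V\<close> avoids an edge set as parameter; the term \<open>x = y\<close> is 0
  whatever \<omega> is on singletons.\<close>

definition stress_op :: "'a set \<Rightarrow> ('a set \<Rightarrow> real) \<Rightarrow> ('a \<Rightarrow> real) \<Rightarrow> 'a \<Rightarrow> real" where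
  "stress_op V \<omega> h y = (\<Sum>x\<in>V. \<omega> {x, y} * (h x - h y))"

text \<open>The weights sit on unordered pairs, so the matrix is symmetric: the diagonal
  contributions cancel and the others are exchanged by swapping the sums.\<close>

lemma stress_op_symmetric:
  "(\<Sum>y\<in>V. g y * stress_op V \<omega> h y) = (\<Sum>y\<in>V. h y * stress_op V \<omega> g y)"
proof -
  have "(\<Sum>y\<in>V. g y * stress_op V \<omega> h y - h y * stress_op V \<omega> g y) =
      (\<Sum>y\<in>V. \<Sum>x\<in>V. \<omega> {x, y} * (g y * h x)) - (\<Sum>y\<in>V. \<Sum>x\<in>V. \<omega> {x, y} * (g x * h y))"
    by (simp add: stress_op_def sum_distrib_left sum_subtractf[symmetric] algebra_simps)
  also have "(\<Sum>y\<in>V. \<Sum>x\<in>V. \<omega> {x, y} * (g x * h y)) = (\<Sum>y\<in>V. \<Sum>x\<in>V. \<omega> {x, y} * (g y * h x))"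
    by (subst sum.swap) (simp add: insert_commute)
  finally show ?thesis
    by (simp add: sum_subtractf)
qed

lemma stress_op_add: "stress_op V (\<lambda>e. \<omega> e + \<tau> e) h y = stress_op V \<omega> h y + stress_op V \<tau> h y"
  by (simp add: stress_op_def algebra_simps sum.distrib sum_subtractf)

lemma stress_op_scale: "stress_op V (\<lambda>e. t * \<omega> e) h y = t * stress_op V \<omega> h y"
  by (simp add: stress_op_def sum_distrib_left mult.assoc)

lemma stress_op_potential_scale: "stress_op V \<omega> (\<lambda>x. t * h x) y = t * stress_op V \<omega> h y"
  by (simp add: stress_op_def sum_distrib_left algebra_simps)

text \<open>Equilibrium is read coordinatewise: both coordinate functions of \<open>p\<close> lie in
  the kernel of the Laplacian. As \<omega> vanishes off \<open>E\<close>, the sum over neighbours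
  extends to \<open>V\<close>.\<close>

lemma stress_space_iff:
  assumes "finite V" "\<And>e. e \<in> E \<Longrightarrow> e \<subseteq> V"
  shows "\<omega> \<in> stress_space (V, E) p \<longleftrightarrow>
    (\<forall>e. e \<notin> E \<longrightarrow> \<omega> e = 0) \<and> (\<forall>y\<in>V. \<forall>k. stress_op V \<omega> (\<lambda>x. p x $ k) y = 0)"
proof -
  have "(\<Sum>x | {x, y} \<in> E. \<omega> {x, y} *\<^sub>R (p x - p y)) $ k = stress_op V \<omega> (\<lambda>x. p x $ k) y"
    if "\<forall>e. e \<notin> E \<longrightarrow> \<omega> e = 0" for y k
  proof -
    have "(\<Sum>x | {x, y} \<in> E. \<omega> {x, y} *\<^sub>R (p x - p y)) $ k =
        (\<Sum>x | {x, y} \<in> E. \<omega> {x, y} * (p x $ k - p y $ k))"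
      by simp
    also have "\<dots> = stress_op V \<omega> (\<lambda>x. p x $ k) y"
      unfolding stress_op_def using that assms by (intro sum.mono_neutral_left) auto
    finally show ?thesis .
  qed
  then show ?thesis
    by (auto simp: stress_space_def vec_eq_iff)
qed

lemma zero_in_stress_space: "(\<lambda>_. 0) \<in> stress_space G p"
  by (simp add: stress_space_def)

lemma stress_space_add:
  assumes "\<omega> \<in> stress_space G p" "\<tau> \<in> stress_space G p"
  shows "(\<lambda>e. \<omega> e + \<tau> e) \<in> stress_space G p"
  using assms by (auto simp: stress_space_def scaleR_add_left sum.distrib)

lemma stress_space_scale:
  assumes "\<omega> \<in> stress_space G p"
  shows "(\<lambda>e. t * \<omega> e) \<in> stress_space G p"
proof -
  have "(\<Sum>x | {x, y} \<in> edges G. (t * \<omega> {x, y}) *\<^sub>R (p x - p y)) =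
      t *\<^sub>R (\<Sum>x | {x, y} \<in> edges G. \<omega> {x, y} *\<^sub>R (p x - p y))" for y
    by (simp add: scaleR_sum_right)
  then show ?thesis
    using assms by (simp add: stress_space_def)
qed

lemma stress_space_sum:
  assumes "\<And>a. a \<in> A \<Longrightarrow> \<omega> a \<in> stress_space G p"
  shows "(\<lambda>e. \<Sum>a\<in>A. \<omega> a e) \<in> stress_space G p"
  using assms
  by (induction A rule: infinite_finite_induct) (auto intro: stress_space_add zero_in_stress_space)

text \<open>Equilibrium depends only on the weights, so any edge set on \<open>V\<close> containing
  the support will do.\<close>

lemma stress_space_change_edges:
  assumes "\<omega> \<in> stress_space (V, E) p" "finite V" "\<And>e. e \<in> E \<Longrightarrow> e \<subseteq> V" "\<And>e. e \<in> F \<Longrightarrow> e \<subseteq> V"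
    and "\<And>e. \<omega> e \<noteq> 0 \<Longrightarrow> e \<in> F"
  shows "\<omega> \<in> stress_space (V, F) p"
  using assms by (auto simp: stress_space_iff)

lemma stress_space_mono:
  assumes "\<omega> \<in> stress_space (V, E) p" "finite V" "\<And>e. e \<in> F \<Longrightarrow> e \<subseteq> V" "E \<subseteq> F"
  shows "\<omega> \<in> stress_space (V, F) p"
proof (rule stress_space_change_edges[OF assms(1,2)])
  show "e \<in> F" if "\<omega> e \<noteq> 0" for e
    using that assms(1,4) by (auto simp: stress_space_def)
qed (use assms(3,4) in auto)

section \<open>Stresses as row dependencies, and matroid circuits\<close>

text \<open>Edges at \<open>y\<close> are reindexed by their other end \<open>x\<close>. The sign
  arises because the row of \<open>{x, y}\<close> has \<open>p y - p x\<close> at \<open>y\<close>,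
  opposite to the difference in the stress equation.\<close>

lemma sum_rigidity_rows:
  assumes "finite V" "\<And>e. e \<in> F \<Longrightarrow> e \<subseteq> V \<and> card e = 2"
  shows "(\<Sum>e\<in>F. c e *\<^sub>R rigidity_row p e y) = - (\<Sum>x | {x, y} \<in> F. c {x, y} *\<^sub>R (p x - p y))"
proof -
  have "finite F"
    using assms by (intro finite_subset[of F "Pow V"]) auto
  then have "(\<Sum>e\<in>F. c e *\<^sub>R rigidity_row p e y) = (\<Sum>e | e \<in> F \<and> y \<in> e. c e *\<^sub>R rigidity_row p e y)"
    by (intro sum.mono_neutral_right) (auto simp: rigidity_row_def)
  also have "\<dots> = (\<Sum>x | {x, y} \<in> F. c {x, y} *\<^sub>R rigidity_row p {x, y} y)"
  proof (rule sum.reindex_bij_betw[symmetric])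
    have "\<exists>x. e = {x, y}" if "e \<in> F" "y \<in> e" for e
      using assms(2)[OF that(1)] that(2) by (auto simp: card_2_iff)
    then show "bij_betw (\<lambda>x. {x, y}) {x. {x, y} \<in> F} {e. e \<in> F \<and> y \<in> e}"
      by (auto simp: bij_betw_def inj_on_def doubleton_eq_iff)
  qed
  also have "\<dots> = (\<Sum>x | {x, y} \<in> F. - (c {x, y} *\<^sub>R (p x - p y)))"
  proof (rule sum.cong)
    fix x assume "x \<in> {x. {x, y} \<in> F}"
    then have "x \<noteq> y"
      using assms(2)[of "{x, y}"] by auto
    then show "c {x, y} *\<^sub>R rigidity_row p {x, y} y = - (c {x, y} *\<^sub>R (p x - p y))"
      by (simp add: rigidity_row_edge flip: scaleR_minus_right)
  qed auto
  finally show ?thesis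
    by (simp add: sum_negf)
qed

text \<open>Coefficients of a row dependency are arbitrary off \<open>F\<close> and are truncated to
  give a stress. Conversely, the stress equations cover only \<open>V\<close>, but no edge of
  \<open>F\<close> meets a point outside \<open>V\<close>.\<close>

lemma rows_independent_iff_stress_space:
  assumes "finite V" "\<And>e. e \<in> F \<Longrightarrow> e \<subseteq> V \<and> card e = 2"
  shows "rows_independent p F \<longleftrightarrow> stress_space (V, F) p \<subseteq> {\<lambda>_. 0}"
proof
  assume ind: "rows_independent p F"
  show "stress_space (V, F) p \<subseteq> {\<lambda>_. 0}"
  proof
    fix \<omega> assume \<omega>: "\<omega> \<in> stress_space (V, F) p"
    have "(\<Sum>e\<in>F. \<omega> e *\<^sub>R rigidity_row p e y) = 0" for y
    proof (cases "y \<in> V")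
      case True
      then show ?thesis
        using \<omega> by (simp add: sum_rigidity_rows[OF assms] stress_space_def)
    next
      case False
      then have "{x. {x, y} \<in> F} = {}"
        using assms(2) by auto
      then show ?thesis
        by (simp add: sum_rigidity_rows[OF assms])
    qed
    then have "\<forall>e\<in>F. \<omega> e = 0"
      using ind by (simp add: rows_independent_def)
    then show "\<omega> \<in> {\<lambda>_. 0}"
      using \<omega> by (auto simp: stress_space_def)
  qed
next
  assume triv: "stress_space (V, F) p \<subseteq> {\<lambda>_. 0}"
  show "rows_independent p F"
    unfolding rows_independent_def
  proof (intro allI impI)
    fix c assume c: "\<forall>y. (\<Sum>e\<in>F. c e *\<^sub>R rigidity_row p e y) = 0"
    have "(\<lambda>e. if e \<in> F then c e else 0) \<in> stress_space (V, F) p"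
    proof -
      have "(\<Sum>x | {x, y} \<in> F. (if {x, y} \<in> F then c {x, y} else 0) *\<^sub>R (p x - p y)) =
          (\<Sum>x | {x, y} \<in> F. c {x, y} *\<^sub>R (p x - p y))" for y
        by (intro sum.cong) auto
      then show ?thesis
        using c by (simp add: stress_space_def sum_rigidity_rows[OF assms])
    qed
    then have "(\<lambda>e. if e \<in> F then c e else 0) = (\<lambda>_. 0)"
      using triv by auto
    then show "\<forall>e\<in>F. c e = 0"
      by (metis (full_types))
  qed
qed

lemma R2_indep_iff_stress_space:
  assumes "simple_graph G" "F \<subseteq> edges G"
  shows "R2_indep G F \<longleftrightarrow> stress_space (verts G, F) (generic_placement (verts G)) \<subseteq> {\<lambda>_. 0}"
proof -
  have "rows_independent (generic_placement (verts G)) F \<longleftrightarrow>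
      stress_space (verts G, F) (generic_placement (verts G)) \<subseteq> {\<lambda>_. 0}"
    using assms by (intro rows_independent_iff_stress_space) (auto simp: simple_graph_def)
  then show ?thesis
    using assms(2) by (simp add: R2_indep_def)
qed

text \<open>A circuit carries a nonzero stress. If it vanished at \<open>e\<close>, it would be a
  stress of the independent set \<open>C - {e}\<close>.\<close>

lemma R2_circuit_stress:
  assumes G: "simple_graph G" and C: "R2_circuit G C" and e: "e \<in> C"
  obtains \<omega> where "\<omega> \<in> stress_space (verts G, C) (generic_placement (verts G))" "\<omega> e \<noteq> 0"
proof -
  let ?p = "generic_placement (verts G)"
  have CE: "C \<subseteq> edges G"
    using C by (simp add: R2_circuit_def)
  have fin: "finite (verts G)" and sub: "\<And>e. e \<in> C \<Longrightarrow> e \<subseteq> verts G"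
    using G CE by (auto simp: simple_graph_def)
  obtain \<omega> where \<omega>: "\<omega> \<in> stress_space (verts G, C) ?p" "\<omega> \<noteq> (\<lambda>_. 0)"
    using C CE R2_indep_iff_stress_space[OF G CE] by (auto simp: R2_circuit_def)
  have "\<omega> e \<noteq> 0"
  proof
    assume "\<omega> e = 0"
    have "\<omega> \<in> stress_space (verts G, C - {e}) ?p"
    proof (rule stress_space_change_edges[OF \<omega>(1) fin])
      show "f \<in> C - {e}" if "\<omega> f \<noteq> 0" for f
        using that \<open>\<omega> e = 0\<close> \<omega>(1) by (auto simp: stress_space_def)
    qed (use sub in auto)
    moreover have "R2_indep G (C - {e})"
      using C e by (auto simp: R2_circuit_def)
    ultimately show False
      using \<omega>(2) CE R2_indep_iff_stress_space[OF G, of "C - {e}"] by auto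
  qed
  then show ?thesis
    using that \<omega>(1) by blast
qed

text \<open>Matroid exchange: an independent set containing \<open>{u, v}\<close> can trade it for
  another edge of the circuit, so deleting \<open>{u, v}\<close> does not lower the rank.\<close>

lemma R2_circuit_imp_two_linked:
  assumes G: "simple_graph G" and C: "R2_circuit G C" and uv: "{u, v} \<in> C"
  shows "two_linked (del_edge G u v) u v"
proof -
  let ?p = "generic_placement (verts G)" and ?D = "del_edge G u v" and ?e = "{u, v}"
  have CE: "C \<subseteq> edges G"
    using C by (simp add: R2_circuit_def)
  have fin: "finite (verts G)" and sub: "\<And>e. e \<in> edges G \<Longrightarrow> e \<subseteq> verts G"
    and c2: "\<And>e. e \<in> edges G \<Longrightarrow> card e = 2"
    using G by (auto simp: simple_graph_def)
  have finE: "finite (edges G)"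
    using sub fin by (intro finite_subset[of "edges G" "Pow (verts G)"]) auto
  have D: "simple_graph ?D" "verts ?D = verts G" "edges ?D = edges G - {?e}"
    using G by (auto simp: simple_graph_def del_edge_def)
  have indD: "R2_indep ?D F \<longleftrightarrow> R2_indep G F \<and> ?e \<notin> F" for F
    by (auto simp: R2_indep_def D)
  let ?cs = "\<lambda>H. {card F | F. R2_indep H F}"
  \<comment> \<open>The rank is the maximum of this set, so equality of the two sets of
    cardinalities suffices.\<close>
  have "?cs G = ?cs ?D"
  proof
    show "?cs ?D \<subseteq> ?cs G"
      using indD by blast
    show "?cs G \<subseteq> ?cs ?D"
    proof clarify
      fix F assume F: "R2_indep G F"
      have FE: "F \<subseteq> edges G"
        using F by (simp add: R2_indep_def)
      have finF: "finite F"
        using FE finE finite_subset by blast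
      have F0: "stress_space (verts G, F) ?p \<subseteq> {\<lambda>_. 0}"
        using F FE R2_indep_iff_stress_space[OF G] by blast
      show "\<exists>F'. card F = card F' \<and> R2_indep ?D F'"
      proof (cases "?e \<in> F")
        case False
        then show ?thesis
          using F indD by blast
      next
        case True
        let ?F = "F - {?e}"
        have "\<exists>f\<in>C - {?e} - ?F. R2_indep G (insert f ?F)"
        proof (rule ccontr)
          assume no: "\<not> ?thesis"
          \<comment> \<open>If no exchange is possible, each remaining circuit edge \<open>f\<close>
            depends on \<open>?F\<close>; its stress is nonzero at \<open>f\<close> because
            \<open>F\<close> is independent, and is scaled to 1 there.\<close>
          have "\<exists>\<tau>. \<tau> \<in> stress_space (verts G, insert f ?F) ?p \<and> \<tau> f = 1"
            if f: "f \<in> C - {?e} - ?F" for f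
          proof -
            have fE: "insert f ?F \<subseteq> edges G"
              using f CE FE by auto
            obtain \<tau> where \<tau>: "\<tau> \<in> stress_space (verts G, insert f ?F) ?p" "\<tau> \<noteq> (\<lambda>_. 0)"
              using no f R2_indep_iff_stress_space[OF G fE] by blast
            have "\<tau> f \<noteq> 0"
            proof
              assume "\<tau> f = 0"
              have "\<tau> \<in> stress_space (verts G, F) ?p"
              proof (rule stress_space_change_edges[OF \<tau>(1) fin])
                show "g \<in> F" if "\<tau> g \<noteq> 0" for g
                  using that \<open>\<tau> f = 0\<close> \<tau>(1) by (auto simp: stress_space_def)
              qed (use sub fE FE in auto)
              then show False
                using F0 \<tau>(2) by auto
            qed
            then show ?thesis
              using stress_space_scale[OF \<tau>(1), of "1 / \<tau> f"]
              by (intro exI[of _ "\<lambda>e. 1 / \<tau> f * \<tau> e"]) auto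
          qed
          then obtain \<tau> where \<tau>: "\<And>f. f \<in> C - {?e} - ?F \<Longrightarrow>
              \<tau> f \<in> stress_space (verts G, insert f ?F) ?p \<and> \<tau> f f = 1"
            by metis
          obtain \<omega> where \<omega>: "\<omega> \<in> stress_space (verts G, C) ?p" "\<omega> ?e \<noteq> 0"
            using R2_circuit_stress[OF G C uv] by blast
          let ?A = "C - {?e} - ?F"
          have finA: "finite ?A"
            using CE finE finite_subset by blast
          \<comment> \<open>Each summand clears one edge of \<open>?A\<close> from the circuit
            stress. What remains is a stress on \<open>F\<close>; its value at \<open>?e\<close> is
            still that of \<omega>, which is nonzero.\<close>
          define \<sigma> where "\<sigma> = (\<lambda>e. \<omega> e + (\<Sum>f\<in>?A. - \<omega> f * \<tau> f e))"
          have \<tau>0: "\<tau> f e = 0" if "f \<in> ?A" "e \<noteq> f" "e \<notin> ?F" for f e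
            using \<tau>[OF that(1)] that(2,3) by (auto simp: stress_space_def)
          have sum0: "(\<Sum>f\<in>B. - \<omega> f * \<tau> f e) = 0" if "B \<subseteq> ?A" "e \<notin> B" "e \<notin> ?F" for B e
          proof (rule sum.neutral, rule ballI)
            fix f assume "f \<in> B"
            then have "f \<in> ?A" "e \<noteq> f"
              using that by blast+
            then show "- \<omega> f * \<tau> f e = 0"
              using \<tau>0 that(3) by simp
          qed
          have "\<sigma> \<in> stress_space (verts G, edges G) ?p"
            unfolding \<sigma>_def
          proof (intro stress_space_add stress_space_sum stress_space_scale)
            show "\<omega> \<in> stress_space (verts G, edges G) ?p"
              by (rule stress_space_mono[OF \<omega>(1) fin sub CE])
            show "\<tau> f \<in> stress_space (verts G, edges G) ?p" if "f \<in> ?A" for f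
            proof -
              have "insert f ?F \<subseteq> edges G"
                using that CE FE by auto
              then show ?thesis
                using \<tau>[OF that] stress_space_mono[OF _ fin sub] by blast
            qed
          qed
          then have "\<sigma> \<in> stress_space (verts G, F) ?p"
          proof (rule stress_space_change_edges[OF _ fin])
            fix e assume "\<sigma> e \<noteq> 0"
            show "e \<in> F"
            proof (rule ccontr)
              assume "e \<notin> F"
              then have nF: "e \<notin> ?F" "e \<noteq> ?e"
                using True by auto
              have "\<sigma> e = 0"
              proof (cases "e \<in> C")
                case True
                then have eA: "e \<in> ?A"
                  using nF by auto
                have "(\<Sum>f\<in>?A. - \<omega> f * \<tau> f e) = - \<omega> e * \<tau> e e + (\<Sum>f\<in>?A - {e}. - \<omega> f * \<tau> f e)"
                  by (rule sum.remove[OF finA eA])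
                also have "(\<Sum>f\<in>?A - {e}. - \<omega> f * \<tau> f e) = 0"
                  using nF(1) by (intro sum0) blast+
                finally show ?thesis
                  using \<tau>[OF eA] by (simp add: \<sigma>_def)
              next
                case False
                then have "\<omega> e = 0"
                  using \<omega>(1) by (auto simp: stress_space_def)
                moreover have "(\<Sum>f\<in>?A. - \<omega> f * \<tau> f e) = 0"
                  using nF(1) False by (intro sum0) blast+
                ultimately show ?thesis
                  by (simp add: \<sigma>_def)
              qed
              then show False
                using \<open>\<sigma> e \<noteq> 0\<close> by simp
            qed
          qed (use sub FE in auto)
          moreover have "\<sigma> ?e = \<omega> ?e"
          proof -
            have "(\<Sum>f\<in>?A. - \<omega> f * \<tau> f ?e) = 0"
              by (intro sum0) blast+
            then show ?thesis
              by (simp add: \<sigma>_def)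
          qed
          ultimately show False
            using F0 \<omega>(2) by auto
        qed
        then obtain f where f: "f \<in> C - {?e} - ?F" "R2_indep G (insert f ?F)"
          by blast
        have "card (insert f ?F) = Suc (card ?F)"
          using f(1) finF by (intro card_insert_disjoint) auto
        then have "card (insert f ?F) = card F"
          by (simp only: card_Suc_Diff1[OF finF True])
        then show ?thesis
          using f indD by (intro exI[of _ "insert f ?F"]) auto
      qed
    qed
  qed
  moreover have "add_edge ?D u v = G"
    using uv CE by (auto simp: add_edge_def del_edge_def prod_eq_iff)
  moreover have "u \<in> verts G" "v \<in> verts G" "u \<noteq> v"
    using sub[of ?e] c2[of ?e] uv CE by (auto simp: card_insert_if)
  ultimately show ?thesis
    unfolding two_linked_def r2_def using D by simp
qed

section \<open>Stresses depending polynomially on the placement\<close>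

text \<open>This form has the edge weights as unknowns and polynomial coefficients, as
  \<open>generic_linear_system\<close> expects.\<close>

lemma stress_space_iff_rigidity_rows:
  assumes "finite V" "\<And>e. e \<in> F \<Longrightarrow> e \<subseteq> V \<and> card e = 2"
  shows "\<omega> \<in> stress_space (V, F) p \<longleftrightarrow>
    (\<forall>e. e \<notin> F \<longrightarrow> \<omega> e = 0) \<and> (\<forall>y\<in>V. \<forall>k. (\<Sum>e\<in>F. rigidity_row p e y $ k * \<omega> e) = 0)"
proof -
  have "(\<Sum>e\<in>F. rigidity_row p e y $ k * \<omega> e) =
      - (\<Sum>x | {x, y} \<in> F. \<omega> {x, y} *\<^sub>R (p x - p y)) $ k" for y k
  proof -
    have "(\<Sum>e\<in>F. rigidity_row p e y $ k * \<omega> e) = (\<Sum>e\<in>F. \<omega> e *\<^sub>R rigidity_row p e y) $ k"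
      by (simp add: mult.commute)
    then show ?thesis
      by (simp only: sum_rigidity_rows[OF assms] uminus_vec_def vec_lambda_beta)
  qed
  then show ?thesis
    by (auto simp: stress_space_def vec_eq_iff)
qed

lemma polyfun_rigidity_row:
  assumes "e \<subseteq> V" "card e = 2"
  shows "polyfun V (\<lambda>p. rigidity_row p e y $ k)"
proof (cases "y \<in> e")
  case True
  then obtain x where x: "e = {y, x}" "x \<noteq> y"
    using assms(2) by (auto simp: card_2_iff doubleton_eq_iff)
  have "polyfun V (\<lambda>p. p y $ k - p x $ k)"
    using x assms(1) by (intro polyfun_intros) auto
  then show ?thesis
    using x by (simp add: rigidity_row_edge)
next
  case False
  then show ?thesis
    by (simp add: rigidity_row_def polyfun_0)
qed

text \<open>Equilibrium together with the normalisation of the weight at \<open>f\<close> to 1 is a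
  linear system solvable at \<open>p0\<close>. After clearing denominators the weight at
  \<open>f\<close> becomes \<open>d\<close>, which is nonzero at generic placements.\<close>

lemma generic_polynomial_stress:
  assumes V: "finite V" "\<And>e. e \<in> C \<Longrightarrow> e \<subseteq> V \<and> card e = 2" and "generic V p0"
    and \<omega>0: "\<omega>0 \<in> stress_space (V, C) p0" "\<omega>0 f \<noteq> 0"
  shows "\<exists>\<omega>. (\<forall>e. polyfun V (\<omega> e)) \<and>
    (\<forall>p. generic V p \<longrightarrow> (\<lambda>e. \<omega> e p) \<in> stress_space (V, C) p \<and> \<omega> f p \<noteq> 0)"
proof -
  have finC: "finite C"
    using V by (intro finite_subset[of C "Pow V"]) auto
  have fC: "f \<in> C"
    using \<omega>0 by (auto simp: stress_space_def)
  \<comment> \<open>\<open>None\<close> indexes the normalisation at \<open>f\<close>, and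
    \<open>Some (y, k)\<close> the equilibrium at \<open>y\<close> in coordinate
    \<open>k\<close>.\<close>
  define I where "I = insert None (Some ` (V \<times> (UNIV :: 2 set)))"
  define A where "A = (\<lambda>i e p. case i of None \<Rightarrow> if e = f then 1 else 0
      | Some (y, k) \<Rightarrow> rigidity_row p e y $ k)"
  define b where "b = (\<lambda>(i :: ('a \<times> 2) option) (p :: 'a \<Rightarrow> real ^ 2). if i = None then 1 else 0 :: real)"
  have A: "(\<Sum>e\<in>C. A None e p * z e) = z f"
    "(\<Sum>e\<in>C. A (Some (y, k)) e p * z e) = (\<Sum>e\<in>C. rigidity_row p e y $ k * z e)" for p z y k
    using fC finC by (auto simp: A_def if_distrib[of "\<lambda>x. x * _"] cong: if_cong)
  have "\<exists>z d. (\<forall>e\<in>C. polyfun V (z e)) \<and> polyfun V d \<and>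
      (\<forall>p. generic V p \<longrightarrow>
        d p \<noteq> 0 \<and> (\<forall>i\<in>I. (\<Sum>e\<in>C. A i e p * z e p) = d p * b i p))"
  proof (rule generic_linear_system[OF finC _ _ assms(3)])
    show "polyfun V (A i e)" if "i \<in> I" "e \<in> C" for i e
      using that V(2)[of e]
      by (cases i) (auto simp: A_def polyfun_0 polyfun_1 polyfun_rigidity_row)
    show "polyfun V (b i)" for i
      by (auto simp: b_def polyfun_0 polyfun_1)
    show "(\<Sum>e\<in>C. A i e p0 * (\<omega>0 e / \<omega>0 f)) = b i p0" if i: "i \<in> I" for i
    proof (cases i)
      case None
      then show ?thesis
        using \<omega>0(2) by (simp only: A) (simp add: b_def)
    next
      case (Some yk)
      then obtain y k where yk: "i = Some (y, k)" "y \<in> V"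
        using i by (cases yk) (auto simp: I_def)
      have "(\<Sum>e\<in>C. rigidity_row p0 e y $ k * \<omega>0 e) = 0"
        using \<omega>0(1) yk(2) stress_space_iff_rigidity_rows[OF V, where p = p0] by blast
      then show ?thesis
        using yk by (simp add: A b_def sum_divide_distrib[symmetric])
    qed
  qed
  then obtain z d where zd: "\<And>e. e \<in> C \<Longrightarrow> polyfun V (z e)"
    "\<And>p. generic V p \<Longrightarrow> d p \<noteq> 0"
    "\<And>p i. generic V p \<Longrightarrow> i \<in> I \<Longrightarrow> (\<Sum>e\<in>C. A i e p * z e p) = d p * b i p"
    by blast
  define \<omega> where "\<omega> = (\<lambda>e. if e \<in> C then z e else (\<lambda>_. 0))"
  have sum\<omega>: "(\<Sum>e\<in>C. g e * \<omega> e p) = (\<Sum>e\<in>C. g e * z e p)" for g p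
    by (auto simp: \<omega>_def intro: sum.cong)
  have "(\<lambda>e. \<omega> e p) \<in> stress_space (V, C) p \<and> \<omega> f p \<noteq> 0" if "generic V p" for p
  proof
    have "(\<Sum>e\<in>C. rigidity_row p e y $ k * \<omega> e p) = 0" if "y \<in> V" for y k
      using zd(3)[OF \<open>generic V p\<close>, of "Some (y, k)"] that
      by (simp add: I_def A b_def sum\<omega>)
    then show "(\<lambda>e. \<omega> e p) \<in> stress_space (V, C) p"
      by (simp add: stress_space_iff_rigidity_rows[OF V] \<omega>_def)
    show "\<omega> f p \<noteq> 0"
      using zd(3)[OF that, of None] zd(2)[OF that] fC by (simp add: I_def A b_def \<omega>_def)
  qed
  moreover have "polyfun V (\<omega> e)" for e
    by (simp add: \<omega>_def zd(1) polyfun_0)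
  ultimately show ?thesis
    by blast
qed

section \<open>The stress of a complete graph on four vertices\<close>

text \<open>For an affine dependency \<open>l\<close> this is a stress of the complete graph on its
  support. The case distinction makes it vanish on sets that are not pairs, as
  \<open>stress_space\<close> demands.\<close>

definition product_stress :: "('a \<Rightarrow> real) \<Rightarrow> 'a set \<Rightarrow> real" where
  "product_stress l e = (if card e = 2 then \<Prod>x\<in>e. l x else 0)"

lemma product_stress_edge: "x \<noteq> y \<Longrightarrow> product_stress l {x, y} = l x * l y"
  by (simp add: product_stress_def)

text \<open>Because the \<open>l x\<close> sum to 0, the Laplacian is the rank one matrix with
  entries \<open>l x * l y\<close>.\<close>

lemma stress_op_product_stress:
  assumes "finite V" "(\<Sum>x\<in>V. l x) = 0"
  shows "stress_op V (product_stress l) h y = l y * (\<Sum>x\<in>V. l x * h x)"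
proof -
  have "stress_op V (product_stress l) h y = (\<Sum>x\<in>V. l y * (l x * h x) - l y * h y * l x)"
    unfolding stress_op_def
  proof (rule sum.cong)
    show "product_stress l {x, y} * (h x - h y) = l y * (l x * h x) - l y * h y * l x" for x
      by (cases "x = y") (auto simp: product_stress_edge algebra_simps)
  qed simp
  also have "\<dots> = l y * (\<Sum>x\<in>V. l x * h x) - l y * h y * (\<Sum>x\<in>V. l x)"
    by (simp add: sum_subtractf sum_distrib_left)
  finally show ?thesis
    using assms(2) by simp
qed

section \<open>Potentials for edges that are not stress-linked\<close>

text \<open>
  Subtracting a multiple of the product stress from a stress of \<open>G\<close> clears the edge \<open>{u, v}\<close>.
  So both coordinates of \<open>q\<close> satisfy the equation for \<open>h\<close> up to a factor, and the factors
  are not both zero since otherwise every stress at \<open>p\<close> would be one at \<open>q\<close>.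
\<close>

lemma not_stress_linked_potential:
  assumes G: "simple_graph G" and uv: "{u, v} \<in> edges G" and nz: "l u \<noteq> 0" "l v \<noteq> 0"
    and l0: "(\<Sum>x\<in>verts G. l x) = 0" and \<kappa>: "product_stress l \<in> stress_space G p"
    and \<omega>: "\<omega> \<in> stress_space G p"
    and sub: "stress_space (del_edge G u v) p \<subseteq> stress_space (del_edge G u v) q"
    and nsub: "\<not> stress_space G p \<subseteq> stress_space G q"
  shows "\<exists>h. (\<Sum>x\<in>verts G. l x * h x) = 1 \<and>
    (\<forall>y\<in>verts G. l u * l v * stress_op (verts G) \<omega> h y = \<omega> {u, v} * l y)"
proof -
  obtain V E where VE: "G = (V, E)"
    by (cases G)
  have V: "finite V" and E: "\<And>e. e \<in> E \<Longrightarrow> e \<subseteq> V" "\<And>e. e \<in> E \<Longrightarrow> card e = 2"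
    using G by (auto simp: simple_graph_def VE)
  have uv': "u \<noteq> v"
    using E(2)[of "{u, v}"] uv by (auto simp: VE)
  define s where "s k = (\<Sum>x\<in>V. l x * q x $ k)" for k
  have key: "l u * l v * stress_op V \<tau> (\<lambda>x. q x $ k) y = \<tau> {u, v} * l y * s k"
    if \<tau>: "\<tau> \<in> stress_space (V, E) p" and y: "y \<in> V" for \<tau> k y
  proof -
    define \<sigma> where "\<sigma> = (\<lambda>e. l u * l v * \<tau> e + - \<tau> {u, v} * product_stress l e)"
    have \<sigma>: "\<sigma> \<in> stress_space (V, E) p"
      unfolding \<sigma>_def using \<tau> \<kappa> by (intro stress_space_add stress_space_scale) (auto simp: VE)
    have "\<sigma> {u, v} = 0"
      by (simp add: \<sigma>_def product_stress_edge[OF uv'])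
    have "\<sigma> \<in> stress_space (V, E - {{u, v}}) p"
    proof (rule stress_space_change_edges[OF \<sigma> V E(1)])
      show "e \<in> E - {{u, v}}" if "\<sigma> e \<noteq> 0" for e
        using that \<open>\<sigma> {u, v} = 0\<close> \<sigma> by (auto simp: stress_space_def)
    qed (use E in auto)
    then have "\<sigma> \<in> stress_space (V, E - {{u, v}}) q"
      using sub by (auto simp: VE del_edge_def)
    then have "stress_op V \<sigma> (\<lambda>x. q x $ k) y = 0"
      using y E stress_space_iff[of V "E - {{u, v}}" \<sigma> q] V by auto
    then show ?thesis
      unfolding \<sigma>_def stress_op_add stress_op_scale
      using stress_op_product_stress[of V l "\<lambda>x. q x $ k" y] V l0 by (simp add: VE s_def)
  qed
  have "\<exists>k. s k \<noteq> 0"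
  proof (rule ccontr)
    assume "\<nexists>k. s k \<noteq> 0"
    then have "\<tau> \<in> stress_space (V, E) q" if \<tau>: "\<tau> \<in> stress_space (V, E) p" for \<tau>
      using key[OF \<tau>] \<tau> nz by (simp add: stress_space_iff[OF V E(1)])
    then show False
      using nsub by (auto simp: VE)
  qed
  then obtain k where k: "s k \<noteq> 0"
    by blast
  show ?thesis
  proof (intro exI conjI ballI)
    show "(\<Sum>x\<in>verts G. l x * (1 / s k * q x $ k)) = 1"
      using k by (simp add: VE s_def sum_divide_distrib[symmetric])
    show "l u * l v * stress_op (verts G) \<omega> (\<lambda>x. 1 / s k * q x $ k) y = \<omega> {u, v} * l y"
      if "y \<in> verts G" for y
      unfolding stress_op_potential_scale using key[of \<omega> y k] that \<omega> k
      by (simp add: VE field_simps)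
  qed
qed

text \<open>The conditions on \<open>h\<close> form a linear system in its values, solvable at
  \<open>p\<close> and therefore at \<open>p0\<close>. Keeping the factor \<open>m\<close> on the
  left instead of dividing by it leaves the coefficients polynomial.\<close>

lemma potential_transfer:
  assumes V: "finite V" and poly: "\<And>x. polyfun V (l x)" "polyfun V m" "\<And>e. polyfun V (\<omega> e)" "polyfun V n"
    and gen: "generic V p" "generic V p0"
    and h: "(\<Sum>x\<in>V. l x p * h x) = 1"
      "\<And>y. y \<in> V \<Longrightarrow> m p * stress_op V (\<lambda>e. \<omega> e p) h y = n p * l y p"
  shows "\<exists>h. (\<Sum>x\<in>V. l x p0 * h x) = 1 \<and>
    (\<forall>y\<in>V. m p0 * stress_op V (\<lambda>e. \<omega> e p0) h y = n p0 * l y p0)"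
proof -
  define I where "I = insert None (Some ` V)"
  \<comment> \<open>Row \<open>Some y\<close> is the row of the Laplacian at \<open>y\<close>, times
    \<open>m\<close>; its diagonal entry carries minus the weighted degree.\<close>
  define A where "A = (\<lambda>i x p. case i of None \<Rightarrow> l x p
      | Some y \<Rightarrow> m p * (\<omega> {x, y} p - (if x = y then \<Sum>z\<in>V. \<omega> {z, y} p else 0)))"
  define b where "b = (\<lambda>i p. case i of None \<Rightarrow> 1 | Some y \<Rightarrow> n p * l y p)"
  have A: "(\<Sum>x\<in>V. A (Some y) x p * g x) = m p * stress_op V (\<lambda>e. \<omega> e p) g y"
    if "y \<in> V" for p y and g :: "'a \<Rightarrow> real"
  proof -
    have "(\<Sum>x\<in>V. A (Some y) x p * g x) = m p * ((\<Sum>x\<in>V. \<omega> {x, y} p * g x)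
        - (\<Sum>x\<in>V. if x = y then (\<Sum>z\<in>V. \<omega> {z, y} p) * g y else 0))"
      unfolding A_def option.case sum_subtractf[symmetric] sum_distrib_left
      by (intro sum.cong) (auto simp: algebra_simps)
    also have "\<dots> = m p * stress_op V (\<lambda>e. \<omega> e p) g y"
      using V that by (simp add: stress_op_def algebra_simps sum_subtractf sum_distrib_left)
    finally show ?thesis .
  qed
  have "\<exists>z d. (\<forall>x\<in>V. polyfun V (z x)) \<and> polyfun V d \<and>
      (\<forall>p. generic V p \<longrightarrow>
        d p \<noteq> 0 \<and> (\<forall>i\<in>I. (\<Sum>x\<in>V. A i x p * z x p) = d p * b i p))"
  proof (rule generic_linear_system[OF V _ _ gen(1)])
    show "polyfun V (A i x)" for i x
    proof (cases i)
      case None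
      then show ?thesis
        using poly by (simp add: A_def)
    next
      case (Some y)
      have "polyfun V (\<lambda>p. m p * (\<omega> {x, y} p - (if x = y then \<Sum>z\<in>V. \<omega> {z, y} p else 0)))"
        by (cases "x = y") (auto intro!: polyfun_intros poly)
      then show ?thesis
        by (simp add: A_def Some)
    qed
    show "polyfun V (b i)" for i
      using poly by (cases i) (auto simp: b_def intro: polyfun_intros)
    show "(\<Sum>x\<in>V. A i x p * h x) = b i p" if "i \<in> I" for i
      using that h A by (auto simp: I_def b_def) (simp add: A_def)
  qed
  then obtain z d where zd: "d p0 \<noteq> 0"
    "\<And>i. i \<in> I \<Longrightarrow> (\<Sum>x\<in>V. A i x p0 * z x p0) = d p0 * b i p0"
    using gen(2) by blast
  show ?thesis
  proof (intro exI conjI ballI)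
    show "(\<Sum>x\<in>V. l x p0 * (1 / d p0 * z x p0)) = 1"
      using zd(1) zd(2)[of None]
      by (simp add: I_def A_def b_def sum_divide_distrib[symmetric])
    show "m p0 * stress_op V (\<lambda>e. \<omega> e p0) (\<lambda>x. 1 / d p0 * z x p0) y = n p0 * l y p0"
      if "y \<in> V" for y
      unfolding stress_op_potential_scale using zd(1) zd(2)[of "Some y"] A[OF that] that
      by (simp add: I_def b_def field_simps)
  qed
qed

text \<open>Pairing the first equation with \<open>h'\<close> and the second with \<open>h\<close>
  gives \<open>m * s = n\<close> and \<open>m' * s = n'\<close> with the same \<open>s\<close>, by
  symmetry of the Laplacian.\<close>

lemma potentials_proportional:
  assumes h: "(\<Sum>x\<in>V. l x * h x) = 1" "\<And>y. y \<in> V \<Longrightarrow> m * stress_op V \<omega> h y = n * l y"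
    and h': "(\<Sum>x\<in>V. l x * h' x) = 1" "\<And>y. y \<in> V \<Longrightarrow> m' * stress_op V \<omega> h' y = n' * l y"
  shows "m * n' = m' * n"
proof -
  have eq: "m * (\<Sum>y\<in>V. g y * stress_op V \<omega> h y) = n"
    if "(\<Sum>x\<in>V. l x * g x) = 1" "\<And>y. y \<in> V \<Longrightarrow> m * stress_op V \<omega> h y = n * l y" for m n g h
  proof -
    have "m * (\<Sum>y\<in>V. g y * stress_op V \<omega> h y) = (\<Sum>y\<in>V. g y * (m * stress_op V \<omega> h y))"
      by (simp add: sum_distrib_left mult.left_commute)
    also have "\<dots> = (\<Sum>y\<in>V. n * (l y * g y))"
      using that(2) by (intro sum.cong) simp_all
    also have "\<dots> = n"
      using that(1) by (simp add: sum_distrib_left[symmetric])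
    finally show ?thesis .
  qed
  have n: "m * (\<Sum>y\<in>V. h' y * stress_op V \<omega> h y) = n"
    by (rule eq) (use h h' in auto)
  have n': "m' * (\<Sum>y\<in>V. h y * stress_op V \<omega> h' y) = n'"
    by (rule eq) (use h h' in auto)
  show ?thesis
    unfolding n[symmetric] n'[symmetric] stress_op_symmetric[of h V \<omega> h']
    by (rule mult.left_commute)
qed

section \<open>The affine dependency of four points\<close>

definition signed_area :: "('a \<Rightarrow> real ^ 2) \<Rightarrow> 'a \<Rightarrow> 'a \<Rightarrow> 'a \<Rightarrow> real" where
  "signed_area p x y z =
     (p y $ 1 - p x $ 1) * (p z $ 2 - p x $ 2) - (p y $ 2 - p x $ 2) * (p z $ 1 - p x $ 1)"

lemma polyfun_signed_area:
  assumes "x \<in> V" "y \<in> V" "z \<in> V"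
  shows "polyfun V (\<lambda>p. signed_area p x y z)"
  unfolding signed_area_def using assms by (intro polyfun_intros)

text \<open>The determinant is 1 for the triangle (0,0), (1,0), (0,1), so it is not the zero
  polynomial.\<close>

lemma generic_signed_area_nonzero:
  assumes "x \<in> V" "y \<in> V" "z \<in> V" "x \<noteq> y" "x \<noteq> z" "y \<noteq> z" "generic V p"
  shows "signed_area p x y z \<noteq> 0"
proof
  assume "signed_area p x y z = 0"
  then have "signed_area (\<lambda>v. if v = x then 0 else if v = y then vector [1, 0] else vector [0, 1])
      x y z = 0"
    by (rule polyfun_generic_zero[OF polyfun_signed_area[OF assms(1-3)] assms(7)])
  then show False
    using assms(4-6) by (simp add: signed_area_def)
qed

text \<open>Cramer's rule: the coefficients are the signed maximal minors of the 3 by 4 matrix with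
  columns \<open>(1, p x)\<close>.\<close>

definition affine_dependency :: "'a \<Rightarrow> 'a \<Rightarrow> 'a \<Rightarrow> 'a \<Rightarrow> 'a \<Rightarrow> ('a \<Rightarrow> real ^ 2) \<Rightarrow> real" where
  "affine_dependency a b c d x p =
     (if x = a then signed_area p b c d else if x = b then - signed_area p a c d
      else if x = c then signed_area p a b d else if x = d then - signed_area p a b c else 0)"

lemma polyfun_affine_dependency:
  assumes "{a, b, c, d} \<subseteq> V"
  shows "polyfun V (affine_dependency a b c d x)"
proof -
  have area: "polyfun V (\<lambda>p. signed_area p b c d)" "polyfun V (\<lambda>p. - signed_area p a c d)"
    "polyfun V (\<lambda>p. signed_area p a b d)" "polyfun V (\<lambda>p. - signed_area p a b c)"
    using assms by (auto intro!: polyfun_signed_area polyfun_uminus)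
  show ?thesis
    unfolding affine_dependency_def
    by (intro polyfun_if area polyfun_0)
qed

lemma affine_dependency_nonzero:
  assumes "{a, b, c, d} \<subseteq> V" "distinct [a, b, c, d]" "generic V p" "x \<in> {a, b, c, d}"
  shows "affine_dependency a b c d x p \<noteq> 0"
  using assms generic_signed_area_nonzero[OF _ _ _ _ _ _ assms(3)]
  by (auto simp: affine_dependency_def)

text \<open>Both sums are expansions of a 4 by 4 determinant with a repeated row; here they are
  checked as polynomial identities.\<close>

lemma affine_dependency_sums:
  assumes "finite V" "{a, b, c, d} \<subseteq> V" "distinct [a, b, c, d]"
  shows "(\<Sum>x\<in>V. affine_dependency a b c d x p) = 0"
    and "(\<Sum>x\<in>V. affine_dependency a b c d x p * p x $ k) = 0"
proof -
  have sum: "(\<Sum>x\<in>V. affine_dependency a b c d x p * g x) =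
      signed_area p b c d * g a - signed_area p a c d * g b
        + signed_area p a b d * g c - signed_area p a b c * g d" for g
  proof -
    have "(\<Sum>x\<in>V. affine_dependency a b c d x p * g x) =
        (\<Sum>x\<in>{a, b, c, d}. affine_dependency a b c d x p * g x)"
      using assms by (intro sum.mono_neutral_right) (auto simp: affine_dependency_def)
    then show ?thesis
      using assms(3) by (auto simp: affine_dependency_def)
  qed
  show "(\<Sum>x\<in>V. affine_dependency a b c d x p) = 0"
    using sum[of "\<lambda>_. 1"] by (simp add: signed_area_def algebra_simps)
  have "k = 1 \<or> k = 2"
    by (rule exhaust_2)
  then show "(\<Sum>x\<in>V. affine_dependency a b c d x p * p x $ k) = 0"
    unfolding sum by (auto simp: signed_area_def algebra_simps)
qed

section \<open>Excluding a complete graph on four vertices\<close>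

lemma complete_graph_4_subgraph:
  assumes "subgraph H G" "graph_isomorphic H (complete_graph 4)"
  shows "\<exists>a b c d. distinct [a, b, c, d] \<and> {a, b, c, d} \<subseteq> verts G \<and>
    (\<forall>x\<in>{a, b, c, d}. \<forall>y\<in>{a, b, c, d}. x \<noteq> y \<longrightarrow> {x, y} \<in> edges G)"
proof -
  obtain f where f: "bij_betw f (verts H) {..<4 :: nat}"
    and fe: "\<And>x y. x \<in> verts H \<Longrightarrow> y \<in> verts H \<Longrightarrow>
      {x, y} \<in> edges H \<longleftrightarrow> {f x, f y} \<in> edges (complete_graph 4)"
    using assms(2) by (auto simp: graph_isomorphic_def complete_graph_def)
  have inj: "inj_on f (verts H)"
    using f by (simp add: bij_betw_def)
  have "card (verts H) = 4"
    using bij_betw_same_card[OF f] by simp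
  then obtain xs where xs: "set xs = verts H" "distinct xs" "length xs = 4"
    using assms(1) finite_distinct_list[of "verts H"] distinct_card
    by (fastforce simp: subgraph_def simple_graph_def)
  then obtain a b c d where abcd: "xs = [a, b, c, d]"
    by (auto simp: length_Suc_conv numeral_eq_Suc)
  have edge: "{x, y} \<in> edges G" if "x \<in> verts H" "y \<in> verts H" "x \<noteq> y" for x y
  proof -
    have "f x \<noteq> f y" "f x < 4" "f y < 4"
      using that inj f by (auto simp: inj_on_def bij_betw_def)
    then have "{f x, f y} \<in> edges (complete_graph 4)"
      by (simp add: complete_graph_def)
    then show ?thesis
      using fe that assms(1) by (auto simp: subgraph_def)
  qed
  have K: "{a, b, c, d} = verts H"
    using xs(1) abcd by simp
  have "distinct [a, b, c, d]"
    using xs(2) abcd by (simp only:)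
  moreover have "{a, b, c, d} \<subseteq> verts G"
    unfolding K using assms(1) by (simp add: subgraph_def)
  moreover have "\<forall>x\<in>{a, b, c, d}. \<forall>y\<in>{a, b, c, d}. x \<noteq> y \<longrightarrow> {x, y} \<in> edges G"
    unfolding K using edge by (intro ballI impI)
  ultimately have "distinct [a, b, c, d] \<and> {a, b, c, d} \<subseteq> verts G \<and>
      (\<forall>x\<in>{a, b, c, d}. \<forall>y\<in>{a, b, c, d}. x \<noteq> y \<longrightarrow> {x, y} \<in> edges G)"
    by (intro conjI)
  then show ?thesis
    by - ((rule exI)+, assumption)
qed

theorem theorem6p2:
  fixes G :: "'a graph"
  assumes "simple_graph G"
    and "R2_connected G"
    and "two_stress_independent G"
    and "card (verts G) \<ge> 5"
  shows "\<not> (\<exists>H. subgraph H G \<and> graph_isomorphic H (complete_graph 4))"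
proof
  assume "\<exists>H. subgraph H G \<and> graph_isomorphic H (complete_graph 4)"
  then obtain H where H: "subgraph H G" "graph_isomorphic H (complete_graph 4)"
    by blast
  obtain a b c d where dist: "distinct [a, b, c, d]" and KV: "{a, b, c, d} \<subseteq> verts G"
    and KE: "\<forall>x\<in>{a, b, c, d}. \<forall>y\<in>{a, b, c, d}. x \<noteq> y \<longrightarrow> {x, y} \<in> edges G"
    using complete_graph_4_subgraph[OF H] by (elim exE conjE) (rule that)
  define K where "K = {a, b, c, d}"
  define P where "P = generic_placement (verts G)"
  obtain V E where VE: "G = (V, E)"
    by (cases G)
  note G = assms(1)
  have V: "finite V" and E: "\<And>e. e \<in> E \<Longrightarrow> e \<subseteq> V" "\<And>e. e \<in> E \<Longrightarrow> card e = 2"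
    using G by (auto simp: simple_graph_def VE)
  have KV': "{a, b, c, d} \<subseteq> V"
    using KV by (simp only: VE fst_conv)
  have KE': "{x, y} \<in> E" if "x \<in> K" "y \<in> K" "x \<noteq> y" for x y
    using KE[folded K_def] that by (simp add: VE)
  \<comment> \<open>A fifth vertex \<open>w\<close> lies on some edge \<open>f\<close>, since no
    vertex is isolated; \<open>f\<close> is not an edge of the copy of
    \<open>K\<^sub>4\<close>.\<close>
  have "card K = 4"
    using dist by (simp add: K_def)
  then have "\<not> V \<subseteq> K"
    using assms(4) card_mono[of K V] by (auto simp: VE K_def)
  then obtain w where w: "w \<in> V" "w \<notin> K"
    by blast
  then obtain f where f: "f \<in> E" "w \<in> f"
    using assms(2) by (auto simp: R2_connected_def VE)
  have circuit: "\<exists>C. R2_circuit G C \<and> {x, y} \<in> C \<and> f \<in> C" if "x \<in> K" "y \<in> K" "x \<noteq> y" for x y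
  proof -
    have "{x, y} \<noteq> f"
      using w f that by auto
    then show ?thesis
      using assms(2) KE'[OF that] f(1) unfolding R2_connected_def VE by auto
  qed
  have not_linked: "\<exists>p q. generic V p \<and> stress_space (del_edge G x y) p \<subseteq> stress_space (del_edge G x y) q \<and>
      \<not> stress_space G p \<subseteq> stress_space G q" if xy: "x \<in> K" "y \<in> K" "x \<noteq> y" for x y
  proof -
    \<comment> \<open>The pair is 2-linked, so what fails is the inclusion of stress spaces. The
      witnesses depend on \<open>x\<close> and \<open>y\<close>.\<close>
    have "two_linked (del_edge G x y) x y"
      using circuit[OF xy] R2_circuit_imp_two_linked[OF G] by blast
    moreover have "\<not> two_stress_linked (del_edge G x y) x y"
      using assms(3) KE'[OF xy] by (auto simp: two_stress_independent_def VE)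
    moreover have "add_edge (del_edge G x y) x y = G" "verts (del_edge G x y) = V"
      using KE'[OF xy] by (auto simp: add_edge_def del_edge_def VE)
    ultimately show ?thesis
      by (auto simp: two_stress_linked_def)
  qed
  have ab: "a \<in> K" "b \<in> K" "a \<noteq> b"
    using dist by (auto simp: K_def)
  \<comment> \<open>A witness just found shows that generic placements exist, so the one chosen by
    \<open>SOME\<close> is generic.\<close>
  obtain p where "generic V p"
    using not_linked[OF ab] by blast
  then have P: "generic V P"
    unfolding P_def generic_placement_def VE using \<open>generic V p\<close> by (simp add: someI[of "generic V"])
  obtain C where C: "R2_circuit G C" "{a, b} \<in> C" "f \<in> C"
    using circuit[OF ab] by blast
  have CE: "C \<subseteq> E"
    using C(1) by (simp add: R2_circuit_def VE)
  obtain \<omega>0 where \<omega>0: "\<omega>0 \<in> stress_space (V, C) P" "\<omega>0 f \<noteq> 0"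
    using R2_circuit_stress[OF G C(1,3)] by (auto simp: P_def VE)
  \<comment> \<open>One polynomial family of circuit stresses can be evaluated both at
    \<open>P\<close> and at every witness placement.\<close>
  obtain \<omega> where poly: "\<And>e. polyfun V (\<omega> e)"
    and \<omega>: "\<And>p. generic V p \<Longrightarrow> (\<lambda>e. \<omega> e p) \<in> stress_space (V, C) p"
      "\<And>p. generic V p \<Longrightarrow> \<omega> f p \<noteq> 0"
  proof -
    have "e \<subseteq> V \<and> card e = 2" if "e \<in> C" for e
      using that CE E by blast
    from generic_polynomial_stress[OF V this P \<omega>0] that show thesis
      by blast
  qed
  define l where "l = affine_dependency a b c d"
  have lpoly: "polyfun V (l x)" for x
    unfolding l_def by (rule polyfun_affine_dependency[OF KV'])
  have lnz: "l x p \<noteq> 0" if "generic V p" "x \<in> K" for x p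
    using affine_dependency_nonzero[OF KV' dist] that by (auto simp: l_def K_def)
  have l0: "l x p = 0" if "x \<notin> K" for x p
    using that by (simp add: l_def affine_dependency_def K_def)
  have lsum: "(\<Sum>x\<in>V. l x p) = 0" "(\<Sum>x\<in>V. l x p * p x $ k) = 0" for p k
    unfolding l_def using affine_dependency_sums[OF V KV' dist] by auto
  have \<kappa>0: "product_stress (\<lambda>x. l x p) e = 0" if "x \<in> e" "x \<notin> K" for e x p
    using that l0[of x p] by (auto simp: product_stress_def card_2_iff)
  have \<kappa>: "product_stress (\<lambda>x. l x p) \<in> stress_space (V, E) p" for p
  proof -
    have "product_stress (\<lambda>x. l x p) e = 0" if "e \<notin> E" for e
    proof (cases "card e = 2")
      case True
      then obtain x y where "e = {x, y}" "x \<noteq> y"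
        by (auto simp: card_2_iff)
      then show ?thesis
        using \<kappa>0[of x e p] \<kappa>0[of y e p] KE'[of x y] that by auto
    qed (simp add: product_stress_def)
    then show ?thesis
      using lsum by (simp add: stress_space_iff[OF V E(1)] stress_op_product_stress[OF V])
  qed
  have potential: "\<exists>h. (\<Sum>z\<in>V. l z P * h z) = 1 \<and>
      (\<forall>z\<in>V. (l x P * l y P) * stress_op V (\<lambda>e. \<omega> e P) h z = \<omega> {x, y} P * l z P)"
    if xy: "x \<in> K" "y \<in> K" "x \<noteq> y" for x y
  proof -
    obtain p q where p: "generic V p"
      and pq: "stress_space (del_edge G x y) p \<subseteq> stress_space (del_edge G x y) q"
        "\<not> stress_space G p \<subseteq> stress_space G q"
      using not_linked[OF xy] by blast
    have "(\<lambda>e. \<omega> e p) \<in> stress_space (V, E) p"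
      by (rule stress_space_mono[OF \<omega>(1)[OF p] V E(1) CE])
    then have "\<exists>h. (\<Sum>z\<in>verts G. l z p * h z) = 1 \<and> (\<forall>z\<in>verts G.
        (l x p * l y p) * stress_op (verts G) (\<lambda>e. \<omega> e p) h z = \<omega> {x, y} p * l z p)"
      using lsum(1) \<kappa> KE'[OF xy]
      by (intro not_stress_linked_potential[OF G _ lnz[OF p xy(1)] lnz[OF p xy(2)] _ _ _ pq])
        (simp_all add: VE)
    then obtain h where h: "(\<Sum>z\<in>V. l z p * h z) = 1"
      "\<And>z. z \<in> V \<Longrightarrow> (l x p * l y p) * stress_op V (\<lambda>e. \<omega> e p) h z = \<omega> {x, y} p * l z p"
      unfolding VE fst_conv by blast
    show ?thesis
      by (rule potential_transfer[OF V lpoly polyfun_mult[OF lpoly lpoly] poly poly p P h])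
  qed
  have proportional: "l x P * l y P * \<omega> {a, b} P = l a P * l b P * \<omega> {x, y} P"
    if xy: "x \<in> K" "y \<in> K" "x \<noteq> y" for x y
  proof -
    obtain h where h: "(\<Sum>z\<in>V. l z P * h z) = 1" "\<And>z. z \<in> V \<Longrightarrow>
        (l x P * l y P) * stress_op V (\<lambda>e. \<omega> e P) h z = \<omega> {x, y} P * l z P"
      using potential[OF xy] by blast
    obtain h' where h': "(\<Sum>z\<in>V. l z P * h' z) = 1" "\<And>z. z \<in> V \<Longrightarrow>
        (l a P * l b P) * stress_op V (\<lambda>e. \<omega> e P) h' z = \<omega> {a, b} P * l z P"
      using potential[OF ab] by blast
    show ?thesis
      by (rule potentials_proportional[OF h h'])
  qed
  \<comment> \<open>By \<open>proportional\<close>, \<open>t\<close> is the ratio of the circuit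
    stress to the product stress on every edge of the copy, so the difference vanishes on all
    six.\<close>
  define t where "t = \<omega> {a, b} P / (l a P * l b P)"
  define \<sigma> where "\<sigma> = (\<lambda>e. \<omega> e P + - t * product_stress (\<lambda>x. l x P) e)"
  have \<sigma>K: "\<sigma> {x, y} = 0" if xy: "x \<in> K" "y \<in> K" "x \<noteq> y" for x y
    using proportional[OF xy] lnz[OF P] ab by (simp add: \<sigma>_def t_def product_stress_edge[OF xy(3)] field_simps)
  have \<sigma>E: "\<sigma> \<in> stress_space (V, E) P"
    unfolding \<sigma>_def
    by (intro stress_space_add stress_space_scale \<kappa>) (rule stress_space_mono[OF \<omega>(1)[OF P] V E(1) CE])
  have "\<sigma> \<in> stress_space (V, C - {{a, b}}) P"
  proof (rule stress_space_change_edges[OF \<sigma>E V E(1)])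
    fix e assume e: "\<sigma> e \<noteq> 0"
    then have "e \<in> E"
      using \<sigma>E by (auto simp: stress_space_def)
    then obtain x y where xy: "e = {x, y}" "x \<noteq> y"
      using E(2)[of e] by (auto simp: card_2_iff)
    \<comment> \<open>An edge with nonzero weight leaves \<open>K\<close>, where the product stress
      vanishes; there the difference equals the circuit stress, supported on
      \<open>C\<close>.\<close>
    then have "x \<notin> K \<or> y \<notin> K"
      using \<sigma>K e by auto
    then have "product_stress (\<lambda>x. l x P) e = 0"
      using \<kappa>0 xy by blast
    then have "\<omega> e P \<noteq> 0"
      using e by (simp add: \<sigma>_def)
    then have "e \<in> C"
      using \<omega>(1)[OF P] by (auto simp: stress_space_def)
    then show "e \<in> C - {{a, b}}"
      using e \<sigma>K[OF ab] by auto
  qed (use CE E in auto)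
  moreover have "R2_indep G (C - {{a, b}})"
    using C by (auto simp: R2_circuit_def)
  ultimately have "\<sigma> = (\<lambda>_. 0)"
    using R2_indep_iff_stress_space[OF G, of "C - {{a, b}}"] CE by (auto simp: VE P_def)
  \<comment> \<open>The end \<open>w\<close> of \<open>f\<close> lies outside \<open>K\<close>, so
    the nonzero circuit stress at \<open>f\<close> was not altered.\<close>
  moreover have "\<sigma> f = \<omega> f P"
    using \<kappa>0[OF f(2) w(2)] by (simp add: \<sigma>_def)
  ultimately show False
    using \<omega>(2)[OF P] by simp
qed

end
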